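(* For every $n\ge 1$, every $\varepsilon\in(0,(2n)^{-1}]$, and every finite subset $\mathcal{M}\subset\mathcal{D}_{n,\varepsilon}$, the semigroup $\operatorname{cl}\langle\mathcal{M}\rangle$ is finitely generated and profinite.
   Context: $\mathcal{D}_n$ is the set of $n\times n$ doubly stochastic matrices (non-negative real, every row and column sums to $1$). For $\varepsilon\in(0,(2n)^{-1}]$, a matrix $M\in\mathcal{D}_n$ is $\varepsilon$-domestic if there do not exist subsets $X,Y\subseteq\{1,\ldots,n\}$ with $X\neq Y$, $|X|=|Y|$ and $\sum_{i\in X,j\in Y}M[i,j]>(1-\varepsilon)|X|$. $\mathcal{D}_{n,\varepsilon}$ is the set of all $\varepsilon$-domestic matrices in $\mathcal{D}_n$; it is a topological semigroup (containing the identity matrix) under matrix multiplication with the standard topology. $\langle\mathcal{M}\rangle$ is the subsemigroup generated by $\mathcal{M}$, by convention also containing the identity; $\operatorname{cl}$ is topological closure (the closure of a subsemigroup of a topological semigroup is a subsemigroup). Finitely generated means equal to $\langle F\rangle$ for some finite set $F$. A topological semigroup is profinite if it is a projective limit of finite discrete semigroups. *)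

theory Defs
  imports "HOL-Analysis.Analysis"
begin

definition doubly_stochastic :: "(real ^ 'n ^ 'n) set" where
  "doubly_stochastic = {A. (\<forall>i j. A $ i $ j \<ge> 0) \<and>
     (\<forall>i. (\<Sum>j\<in>UNIV. A $ i $ j) = 1) \<and> (\<forall>j. (\<Sum>i\<in>UNIV. A $ i $ j) = 1)}"

definition domestic_matrices :: "real \<Rightarrow> (real ^ 'n ^ 'n) set" where
  "domestic_matrices \<epsilon> = {A \<in> doubly_stochastic.
     \<not> (\<exists>X Y. X \<noteq> Y \<and> card X = card Y \<and>
            (\<Sum>i\<in>X. \<Sum>j\<in>Y. A $ i $ j) > (1 - \<epsilon>) * real (card X))}"

inductive_set generated_semigroup :: "(real ^ 'n ^ 'n) set \<Rightarrow> (real ^ 'n ^ 'n) set"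
  for \<M> :: "(real ^ 'n ^ 'n) set" where
  identity: "mat 1 \<in> generated_semigroup \<M>"
| generator: "A \<in> \<M> \<Longrightarrow> A \<in> generated_semigroup \<M>"
| product: "A \<in> generated_semigroup \<M> \<Longrightarrow> B \<in> generated_semigroup \<M> \<Longrightarrow>
    A ** B \<in> generated_semigroup \<M>"

definition finitely_generated :: "(real ^ 'n ^ 'n) set \<Rightarrow> bool" where
  "finitely_generated S \<longleftrightarrow> (\<exists>F. finite F \<and> S = generated_semigroup F)"

definition semigroup_on :: "'a set \<Rightarrow> ('a \<Rightarrow> 'a \<Rightarrow> 'a) \<Rightarrow> bool" where
  "semigroup_on S f \<longleftrightarrow> (\<forall>x\<in>S. \<forall>y\<in>S. f x y \<in> S) \<and>
     (\<forall>x\<in>S. \<forall>y\<in>S. \<forall>z\<in>S. f (f x y) z = f x (f y z))"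

definition semigroup_hom_on ::
  "'a set \<Rightarrow> ('a \<Rightarrow> 'a \<Rightarrow> 'a) \<Rightarrow> 'b set \<Rightarrow> ('b \<Rightarrow> 'b \<Rightarrow> 'b) \<Rightarrow> ('a \<Rightarrow> 'b) \<Rightarrow> bool" where
  "semigroup_hom_on S f T g h \<longleftrightarrow>
     h \<in> S \<rightarrow> T \<and> (\<forall>x\<in>S. \<forall>y\<in>S. h (f x y) = g (h x) (h y))"

definition topological_semigroup :: "'a topology \<Rightarrow> ('a \<Rightarrow> 'a \<Rightarrow> 'a) \<Rightarrow> bool" where
  "topological_semigroup X f \<longleftrightarrow> semigroup_on (topspace X) f \<and>
     continuous_map (prod_topology X X) X (\<lambda>(x, y). f x y)"

text \<open>Inverse system of finite semigroups \<open>(T i, g i)\<close> over a directed preordered set \<open>(I, le)\<close>;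
  \<open>p i j\<close> is the connecting map \<open>T j \<rightarrow> T i\<close> for \<open>le i j\<close>.\<close>

locale finite_semigroup_inverse_system =
  fixes I :: "'i set" and le :: "'i \<Rightarrow> 'i \<Rightarrow> bool"
    and T :: "'i \<Rightarrow> 't set" and g :: "'i \<Rightarrow> 't \<Rightarrow> 't \<Rightarrow> 't"
    and p :: "'i \<Rightarrow> 'i \<Rightarrow> 't \<Rightarrow> 't"
  assumes nonempty: "I \<noteq> {}"
    and le_refl: "i \<in> I \<Longrightarrow> le i i"
    and le_trans: "\<lbrakk>i \<in> I; j \<in> I; k \<in> I; le i j; le j k\<rbrakk> \<Longrightarrow> le i k"
    and directed: "\<lbrakk>i \<in> I; j \<in> I\<rbrakk> \<Longrightarrow> \<exists>k\<in>I. le i k \<and> le j k"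
    and finite_carrier: "i \<in> I \<Longrightarrow> finite (T i)"
    and semigroup: "i \<in> I \<Longrightarrow> semigroup_on (T i) (g i)"
    and connecting_hom: "\<lbrakk>i \<in> I; j \<in> I; le i j\<rbrakk> \<Longrightarrow> semigroup_hom_on (T j) (g j) (T i) (g i) (p i j)"
    and connecting_id: "\<lbrakk>i \<in> I; x \<in> T i\<rbrakk> \<Longrightarrow> p i i x = x"
    and connecting_comp: "\<lbrakk>i \<in> I; j \<in> I; k \<in> I; le i j; le j k; x \<in> T k\<rbrakk> \<Longrightarrow> p i j (p j k x) = p i k x"

definition projective_limit ::
  "'i set \<Rightarrow> ('i \<Rightarrow> 'i \<Rightarrow> bool) \<Rightarrow> ('i \<Rightarrow> 't set) \<Rightarrow> ('i \<Rightarrow> 'i \<Rightarrow> 't \<Rightarrow> 't) \<Rightarrow> ('i \<Rightarrow> 't) set" where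
  "projective_limit I le T p =
     {x \<in> PiE I T. \<forall>i\<in>I. \<forall>j\<in>I. le i j \<longrightarrow> p i j (x j) = x i}"

definition projective_limit_topology ::
  "'i set \<Rightarrow> ('i \<Rightarrow> 'i \<Rightarrow> bool) \<Rightarrow> ('i \<Rightarrow> 't set) \<Rightarrow> ('i \<Rightarrow> 'i \<Rightarrow> 't \<Rightarrow> 't) \<Rightarrow> ('i \<Rightarrow> 't) topology" where
  "projective_limit_topology I le T p =
     subtopology (product_topology (\<lambda>i. discrete_topology (T i)) I) (projective_limit I le T p)"

definition projective_limit_mult ::
  "'i set \<Rightarrow> ('i \<Rightarrow> 't \<Rightarrow> 't \<Rightarrow> 't) \<Rightarrow> ('i \<Rightarrow> 't) \<Rightarrow> ('i \<Rightarrow> 't) \<Rightarrow> ('i \<Rightarrow> 't)" where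
  "projective_limit_mult I g x y = (\<lambda>i\<in>I. g i (x i) (y i))"

text \<open>HOL cannot quantify over types, so the types of the inverse system are fixed, without loss
  of generality: every finite semigroup is isomorphic to one with carrier in \<open>nat\<close>, and every
  profinite semigroup is the projective limit of its quotients by the clopen congruences of
  finite index, which are elements of the index type \<open>('a \<times> 'a) set\<close>.\<close>

definition profinite_semigroup :: "'a topology \<Rightarrow> ('a \<Rightarrow> 'a \<Rightarrow> 'a) \<Rightarrow> bool" where
  "profinite_semigroup X f \<longleftrightarrow> topological_semigroup X f \<and>
     (\<exists>(I :: ('a \<times> 'a) set set) le (T :: ('a \<times> 'a) set \<Rightarrow> nat set) g p h.
        finite_semigroup_inverse_system I le T g p \<and>
        homeomorphic_map X (projective_limit_topology I le T p) h \<and>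
        semigroup_hom_on (topspace X) f (projective_limit I le T p) (projective_limit_mult I g) h)"

end

theory Submission
  imports Defs
begin

text \<open>
  A domestic matrix \<open>A\<close> is a Euclidean contraction, and \<open>\<parallel>A x\<parallel> = \<parallel>x\<parallel>\<close> forces \<open>A x = x\<close>: equality
  makes every level set of \<open>A x\<close> and the corresponding level set of \<open>x\<close> a pair \<open>X, Y\<close> of equal size
  carrying the full mass \<open>|X|\<close>, so \<open>X = Y\<close>.

  For a finite set \<open>N\<close> of such matrices, all words using every letter of \<open>N\<close> contract the orthogonal
  complement of the common fixed space by one constant \<open>q < 1\<close>. A limit of words is therefore
  either a limit of words with a bounded number of blocks using all of \<open>N\<close>, hence a product of
  letters and limits of words over proper subsets of \<open>N\<close>, or the orthogonal projection onto the
  common fixed space. By induction on \<open>N\<close> the closure is finitely generated.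

  In particular the closure is countable and compact, so clopen sets separate its points, and the
  syntactic congruences of these clopen sets exhibit it as a projective limit of finite semigroups.
\<close>

section \<open>Domestic matrices as paracontractions\<close>

text \<open>Row \<open>i\<close> of \<open>A\<close> is a probability vector and
  \<open>(A *v x) $ i\<close> is the mean of the entries of \<open>x\<close> under it, so the inner
  sum is a variance: mean of squares minus square of the mean. Unit column sums turn the total of
  the mean squares into |x|^2.\<close>

lemma doubly_stochastic_norm_deficit:
  fixes A :: "real ^ 'n ^ 'n" and x :: "real ^ 'n"
  assumes "A \<in> doubly_stochastic"
  shows "(norm x)\<^sup>2 - (norm (A *v x))\<^sup>2 = (\<Sum>i\<in>UNIV. \<Sum>j\<in>UNIV. A $ i $ j * (x $ j - (A *v x) $ i)\<^sup>2)"
proof -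
  define y where "y = A *v x"
  have row: "(\<Sum>j\<in>UNIV. A $ i $ j) = 1" and col: "(\<Sum>i\<in>UNIV. A $ i $ j) = 1" for i j
    using assms by (auto simp: doubly_stochastic_def)
  have y: "y $ i = (\<Sum>j\<in>UNIV. A $ i $ j * x $ j)" for i
    by (simp add: y_def matrix_vector_mult_def)
  have "(\<Sum>j\<in>UNIV. A $ i $ j * (x $ j - y $ i)\<^sup>2) = (\<Sum>j\<in>UNIV. A $ i $ j * (x $ j)\<^sup>2) - (y $ i)\<^sup>2" for i
  proof -
    have "(\<Sum>j\<in>UNIV. A $ i $ j * (x $ j - y $ i)\<^sup>2)
      = (\<Sum>j\<in>UNIV. A $ i $ j * (x $ j)\<^sup>2 - 2 * y $ i * (A $ i $ j * x $ j) + (y $ i)\<^sup>2 * A $ i $ j)"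
      by (rule sum.cong) (auto simp: power2_eq_square algebra_simps)
    also have "\<dots> = (\<Sum>j\<in>UNIV. A $ i $ j * (x $ j)\<^sup>2) - 2 * y $ i * y $ i + (y $ i)\<^sup>2 * 1"
      by (simp only: sum.distrib sum_subtractf row y sum_distrib_left[symmetric])
    finally show ?thesis by (simp add: power2_eq_square)
  qed
  then have "(\<Sum>i\<in>UNIV. \<Sum>j\<in>UNIV. A $ i $ j * (x $ j - y $ i)\<^sup>2)
    = (\<Sum>i\<in>UNIV. \<Sum>j\<in>UNIV. A $ i $ j * (x $ j)\<^sup>2) - (\<Sum>i\<in>UNIV. (y $ i)\<^sup>2)"
    by (simp add: sum_subtractf)
  also have "(\<Sum>i\<in>UNIV. \<Sum>j\<in>UNIV. A $ i $ j * (x $ j)\<^sup>2) = (\<Sum>j\<in>UNIV. (x $ j)\<^sup>2)"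
    by (subst sum.swap) (simp add: sum_distrib_right[symmetric] col)
  finally show ?thesis
    by (simp add: y_def power2_norm_eq_inner inner_vec_def) (simp add: power2_eq_square)
qed

text \<open>The classical notion of a paracontracting matrix, for the Euclidean norm. From here on
  the matrices enter only through this property, and \<epsilon> disappears.\<close>

definition paracontraction :: "real ^ 'n ^ 'n \<Rightarrow> bool" where
  "paracontraction A \<longleftrightarrow> (\<forall>x. norm (A *v x) \<le> norm x \<and> (norm (A *v x) = norm x \<longrightarrow> A *v x = x))"

lemma domestic_imp_paracontraction:
  fixes A :: "real ^ 'n ^ 'n"
  assumes "0 < \<epsilon>" and dom: "A \<in> domestic_matrices \<epsilon>"
  shows "paracontraction A"
  unfolding paracontraction_def
proof (intro allI conjI impI)
  fix x :: "real ^ 'n"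
  have ds: "A \<in> doubly_stochastic"
    using dom by (simp add: domestic_matrices_def)
  then have nonneg: "A $ i $ j \<ge> 0" and row: "(\<Sum>j\<in>UNIV. A $ i $ j) = 1"
    and col: "(\<Sum>i\<in>UNIV. A $ i $ j) = 1" for i j
    by (auto simp: doubly_stochastic_def)
  note deficit = doubly_stochastic_norm_deficit[OF ds, of x]
  have "0 \<le> (norm x)\<^sup>2 - (norm (A *v x))\<^sup>2"
    unfolding deficit by (intro sum_nonneg mult_nonneg_nonneg nonneg zero_le_power2)
  then show "norm (A *v x) \<le> norm x"
    using power2_le_imp_le[of "norm (A *v x)" "norm x"] by simp
  assume "norm (A *v x) = norm x"
  then have "(\<Sum>i\<in>UNIV. \<Sum>j\<in>UNIV. A $ i $ j * (x $ j - (A *v x) $ i)\<^sup>2) = 0"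
    using deficit by simp
  then have supp: "A $ i $ j = 0 \<or> x $ j = (A *v x) $ i" for i j
    by (simp add: sum_nonneg_eq_0_iff sum_nonneg nonneg)
  \<comment> \<open>By \<open>supp\<close>, rows in \<open>X\<close> are supported in
    \<open>Y\<close> and columns in \<open>Y\<close> are supported in \<open>X\<close>. Summing the
    block by rows and by columns gives |X| = |Y| and mass |X|. Two empty level sets are set aside
    because the strict inequality needs |X| > 0.\<close>
  have level: "{i. (A *v x) $ i = c} = {j. x $ j = c}" for c
  proof (cases "{i. (A *v x) $ i = c} = {} \<and> {j. x $ j = c} = {}")
    case False
    define X where "X = {i. (A *v x) $ i = c}"
    define Y where "Y = {j. x $ j = c}"
    have "(\<Sum>j\<in>Y. A $ i $ j) = 1" if "i \<in> X" for i
      using that supp[of i] unfolding row[of i, symmetric]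
      by (intro sum.mono_neutral_left) (auto simp: X_def Y_def)
    then have sX: "(\<Sum>i\<in>X. \<Sum>j\<in>Y. A $ i $ j) = card X"
      by simp
    have "(\<Sum>i\<in>X. A $ i $ j) = 1" if "j \<in> Y" for j
      using that supp[where j = j] unfolding col[of j, symmetric]
      by (intro sum.mono_neutral_left) (auto simp: X_def Y_def, metis)
    then have "(\<Sum>i\<in>X. \<Sum>j\<in>Y. A $ i $ j) = card Y"
      by (subst sum.swap) simp
    then have card: "card X = card Y"
      using sX by simp
    have "X \<noteq> {} \<or> Y \<noteq> {}"
      using False by (simp add: X_def Y_def)
    then have "card X > 0"
      using card by (metis card_gt_0_iff finite)
    then have "(\<Sum>i\<in>X. \<Sum>j\<in>Y. A $ i $ j) > (1 - \<epsilon>) * real (card X)"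
      using sX \<open>0 < \<epsilon>\<close> by (simp add: algebra_simps)
    then have "X = Y"
      using dom card not_less unfolding domestic_matrices_def mem_Collect_eq by metis
    then show ?thesis
      by (simp add: X_def Y_def)
  qed simp
  show "A *v x = x"
    using level by (auto simp: vec_eq_iff)
qed

section \<open>Limits of products of paracontractions\<close>

definition matrix_product :: "(real ^ 'n ^ 'n) list \<Rightarrow> real ^ 'n ^ 'n" where
  "matrix_product w = foldr (**) w (mat 1)"

lemma matrix_product_simps [simp]:
  "matrix_product [] = mat 1"
  "matrix_product (a # w) = a ** matrix_product w"
  by (simp_all add: matrix_product_def)

lemma matrix_product_append: "matrix_product (v @ w) = matrix_product v ** matrix_product w"
  by (induction v) (simp_all add: matrix_mul_assoc)

text \<open>Words can be cut at chosen letters, and there are only countably many over a finite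
  alphabet; both facts are used later.\<close>

lemma generated_semigroup_eq: "generated_semigroup N = matrix_product ` lists N"
proof (intro equalityI subsetI)
  fix A assume "A \<in> generated_semigroup N"
  then show "A \<in> matrix_product ` lists N"
  proof induction
    case identity
    show ?case by (rule image_eqI[of _ _ "[]"]) auto
  next
    case (generator A)
    then show ?case by (intro image_eqI[of _ _ "[A]"]) auto
  next
    case (product A B)
    then obtain v w where "v \<in> lists N" "w \<in> lists N" "A = matrix_product v" "B = matrix_product w"
      by blast
    then show ?case
      by (intro image_eqI[of _ _ "v @ w"]) (auto simp: matrix_product_append)
  qed
next
  fix A assume "A \<in> matrix_product ` lists N"
  moreover have "matrix_product w \<in> generated_semigroup N" if "w \<in> lists N" for w
    using that by induction (auto intro: generated_semigroup.intros)
  ultimately show "A \<in> generated_semigroup N" by blast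
qed

lemma generated_semigroup_mono: "N \<subseteq> N' \<Longrightarrow> generated_semigroup N \<subseteq> generated_semigroup N'"
  unfolding generated_semigroup_eq by (intro image_mono lists_mono)

lemma generated_semigroup_least:
  assumes "F \<subseteq> S" "mat 1 \<in> S" "\<And>A B. A \<in> S \<Longrightarrow> B \<in> S \<Longrightarrow> A ** B \<in> S"
  shows "generated_semigroup F \<subseteq> S"
proof
  fix A assume "A \<in> generated_semigroup F"
  then show "A \<in> S" by induction (use assms in auto)
qed

section \<open>Continuity and compactness\<close>

lemma continuous_on_matrix_mult [continuous_intros]:
  fixes f g :: "'a::topological_space \<Rightarrow> real ^ 'n ^ 'n"
  assumes "continuous_on S f" "continuous_on S g"
  shows "continuous_on S (\<lambda>x. f x ** g x)"
  unfolding matrix_matrix_mult_def by (intro continuous_intros assms)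

lemma continuous_on_matrix_vector_mult [continuous_intros]:
  fixes f :: "'a::topological_space \<Rightarrow> real ^ 'n ^ 'n" and g :: "'a \<Rightarrow> real ^ 'n"
  assumes "continuous_on S f" "continuous_on S g"
  shows "continuous_on S (\<lambda>x. f x *v g x)"
  unfolding matrix_vector_mult_def by (intro continuous_intros assms)

text \<open>Such product sets are closed, so one that contains given words also contains their
  limits: limits of factored words factor in the same way.\<close>

lemma compact_matrix_mult_image:
  fixes K L :: "(real ^ 'n ^ 'n) set"
  assumes "compact K" "compact L"
  shows "compact ((\<lambda>(A, B). A ** B) ` (K \<times> L))"
  using assms by (intro compact_continuous_image compact_Times)
    (auto simp: case_prod_unfold intro!: continuous_intros)

lemma closure_generated_semigroup_mult:
  assumes "A \<in> closure (generated_semigroup N)" "B \<in> closure (generated_semigroup N)"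
  shows "A ** B \<in> closure (generated_semigroup N)"
proof -
  let ?S = "generated_semigroup N"
  have "(\<lambda>(A, B). A ** B) ` closure (?S \<times> ?S) \<subseteq> closure ?S"
    by (rule image_closure_subset)
      (auto simp: case_prod_unfold intro!: continuous_intros
        generated_semigroup.product closure_subset[THEN subsetD])
  then show ?thesis
    using assms by (auto simp: closure_Times)
qed

lemma mat_1_in_closure_generated_semigroup: "mat 1 \<in> closure (generated_semigroup N)"
  by (simp add: closure_subset[THEN subsetD] generated_semigroup.identity)

lemma closed_contractions: "closed {A :: real ^ 'n ^ 'n. \<forall>x. norm (A *v x) \<le> norm x}"
  by (intro closed_Collect_all closed_Collect_le continuous_intros)

text \<open>The columns are images of the unit vectors \<open>axis j 1\<close>, so every entry has
  absolute value at most 1.\<close>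

lemma bounded_contractions: "bounded {A :: real ^ 'n ^ 'n. \<forall>x. norm (A *v x) \<le> norm x}"
proof (rule boundedI)
  fix A :: "real ^ 'n ^ 'n"
  assume "A \<in> {A. \<forall>x. norm (A *v x) \<le> norm x}"
  then have A: "norm (A *v x) \<le> norm x" for x by blast
  have "\<bar>A $ i $ j\<bar> \<le> 1" for i j
  proof -
    have "A $ i $ j = (A *v axis j 1) $ i"
      by (simp add: matrix_vector_mult_basis column_def)
    then show ?thesis
      using component_le_norm_cart[of "A *v axis j 1" i] A[of "axis j 1"] by simp
  qed
  then have "norm (A $ i) \<le> real CARD('n)" for i
    using norm_le_l1_cart[of "A $ i"] sum_mono[of UNIV "\<lambda>j. \<bar>A $ i $ j\<bar>" "\<lambda>_. 1"] by fastforce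
  then have "(\<Sum>i\<in>UNIV. norm (A $ i)) \<le> (\<Sum>i\<in>(UNIV :: 'n set). real CARD('n))"
    by (intro sum_mono) auto
  moreover have "norm A \<le> (\<Sum>i\<in>UNIV. norm (A $ i))"
    unfolding norm_vec_def by (rule L2_set_le_sum) simp
  ultimately show "norm A \<le> real CARD('n) * real CARD('n)" by simp
qed

lemma generated_semigroup_contraction:
  assumes "\<And>A. A \<in> N \<Longrightarrow> paracontraction A" "B \<in> generated_semigroup N"
  shows "norm (B *v x) \<le> norm x"
  using assms(2)
proof (induction arbitrary: x)
  case (product A B)
  then show ?case
    by (metis matrix_vector_mul_assoc order_trans)
qed (use assms(1) in \<open>auto simp: paracontraction_def\<close>)

lemma closure_generated_semigroup_contraction:
  assumes "\<And>A. A \<in> N \<Longrightarrow> paracontraction A" "B \<in> closure (generated_semigroup N)"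
  shows "norm (B *v x) \<le> norm x"
proof -
  have "closure (generated_semigroup N) \<subseteq> {A. \<forall>x. norm (A *v x) \<le> norm x}"
    using generated_semigroup_contraction[OF assms(1)]
    by (intro closure_minimal closed_contractions) auto
  then show ?thesis using assms(2) by auto
qed

lemma compact_closure_generated_semigroup:
  assumes "\<And>A. A \<in> N \<Longrightarrow> paracontraction A"
  shows "compact (closure (generated_semigroup N))"
  using closure_generated_semigroup_contraction[OF assms]
  by (intro compact_eq_bounded_closed[THEN iffD2] conjI closed_closure
      bounded_subset[OF bounded_contractions]) auto

section \<open>Common fixed vectors and their orthogonal complement\<close>

definition common_fixed :: "(real ^ 'n ^ 'n) set \<Rightarrow> (real ^ 'n) set" where
  "common_fixed N = {x. \<forall>A\<in>N. A *v x = x}"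

lemma closure_generated_semigroup_fixed:
  assumes "B \<in> closure (generated_semigroup N)" "x \<in> common_fixed N"
  shows "B *v x = x"
proof -
  have "B *v x = x" if "B \<in> generated_semigroup N" for B
    using that
  proof induction
    case (product A B)
    then show ?case
      by (simp add: matrix_vector_mul_assoc[symmetric])
  qed (use assms(2) in \<open>auto simp: common_fixed_def\<close>)
  then have "closure (generated_semigroup N) \<subseteq> {B. B *v x = x}"
    by (intro closure_minimal closed_Collect_eq continuous_intros) auto
  then show ?thesis using assms(1) by auto
qed

text \<open>A fixed vector of a contraction is also fixed by its transpose.\<close>

lemma contraction_fixed_inner:
  fixes A :: "real ^ 'n ^ 'n"
  assumes contr: "\<And>x. norm (A *v x) \<le> norm x" and fixed: "A *v e = e"
  shows "e \<bullet> (A *v y) = e \<bullet> y"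
proof -
  \<comment> \<open>\<open>u\<close> is the transpose of \<open>A\<close> applied to
    \<open>e\<close>; the aim is \<open>u = e\<close>. Testing \<open>u\<close> against itself gives
    |u| <= |e|, and \<open>u\<close> has inner product |e|^2 with \<open>e\<close>, so |u - e|^2 =
    |u|^2 - |e|^2 <= 0.\<close>
  define u where "u = e v* A"
  have u: "u \<bullet> z = e \<bullet> (A *v z)" for z
    by (simp add: u_def dot_lmul_matrix)
  have "u \<bullet> u \<le> norm e * norm u"
    unfolding u by (meson contr mult_left_mono norm_cauchy_schwarz norm_ge_zero order_trans)
  then have "norm u \<le> norm e"
    by (smt (verit) mult_le_cancel_right norm_ge_zero power2_norm_eq_inner power2_eq_square)
  then have "u \<bullet> u \<le> e \<bullet> e"
    by (simp add: norm_le)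
  then have "(norm (u - e))\<^sup>2 \<le> 0"
    by (simp add: power2_norm_eq_inner inner_diff inner_commute[of e u] u[of e] fixed)
  then show ?thesis
    using u[of y] by simp
qed

text \<open>Limits of words are contractions fixing \<open>common_fixed N\<close>, so they preserve
  inner products with its vectors. This lets contraction estimates on the complement be
  iterated.\<close>

lemma orthogonal_complement_fixed_invariant:
  assumes "\<And>A. A \<in> N \<Longrightarrow> paracontraction A" "B \<in> closure (generated_semigroup N)"
    "y \<in> orthogonal_comp (common_fixed N)"
  shows "B *v y \<in> orthogonal_comp (common_fixed N)"
  unfolding orthogonal_comp_def
proof (intro CollectI ballI)
  fix e assume e: "e \<in> common_fixed N"
  show "orthogonal e (B *v y)"
    using contraction_fixed_inner[OF closure_generated_semigroup_contraction[OF assms(1,2)]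
        closure_generated_semigroup_fixed[OF assms(2) e]] assms(3) e
    by (auto simp: orthogonal_def orthogonal_comp_def)
qed

section \<open>Words using every letter\<close>

definition full_products :: "(real ^ 'n ^ 'n) set \<Rightarrow> (real ^ 'n ^ 'n) set" where
  "full_products N = matrix_product ` {w. set w = N}"

lemma full_products_subset: "full_products N \<subseteq> generated_semigroup N"
  by (auto simp: full_products_def generated_semigroup_eq)

text \<open>The shortest suffix with letter set \<open>N\<close> is \<open>a # c\<close>: its head
  does not recur in \<open>c\<close>, as otherwise \<open>c\<close> would still use all of
  \<open>N\<close>.\<close>

lemma full_word_split:
  assumes "set w = N" "N \<noteq> {}"
  shows "\<exists>v a c. w = v @ a # c \<and> a \<in> N \<and> set c = N - {a}"
  using assms(1)
proof (induction w)
  case Nil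
  then show ?case using assms(2) by simp
next
  case (Cons x w)
  show ?case
  proof (cases "set w = N")
    case True
    then obtain v a c where "w = v @ a # c \<and> a \<in> N \<and> set c = N - {a}" using Cons.IH by blast
    then show ?thesis by (intro exI[of _ "x # v"]) auto
  next
    case False
    then show ?thesis using Cons.prems by (intro exI[of _ "[]"]) auto
  qed
qed

text \<open>A limit of paracontractions need not be one, so the limit is factored instead, by
  induction on \<open>N\<close>: as a limit of words, a letter \<open>a\<close>, and a limit of full
  words over \<open>N - {a}\<close>. Each factor must preserve the norm, so the induction hypothesis
  applies to the last one and the paracontraction property to \<open>a\<close>.\<close>

lemma closure_full_products_norm_eq:
  assumes "finite N" "\<And>A. A \<in> N \<Longrightarrow> paracontraction A"
    "B \<in> closure (full_products N)" "norm (B *v y) = norm y"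
  shows "y \<in> common_fixed N"
  using assms
proof (induction N arbitrary: B rule: finite_psubset_induct)
  case (psubset N)
  show ?case
  proof (cases "N = {}")
    case True
    then show ?thesis by (simp add: common_fixed_def)
  next
    case False
    let ?m = "\<lambda>K L. (\<lambda>(A, B). A ** B) ` (K \<times> L)"
    \<comment> \<open>All factorizations given by \<open>full_word_split\<close>, with limits
      allowed in the outer factors. \<open>R\<close> is compact, so it contains the limits of full
      words too.\<close>
    define R where "R = (\<Union>a\<in>N. ?m (closure (generated_semigroup N)) (?m {a} (closure (full_products (N - {a})))))"
    have "compact (closure (full_products (N - {a})))" for a
      using compact_closure_generated_semigroup[of "N - {a}"] psubset.prems(1)
      by (metis DiffD1 closed_closure closed_subset closure_mono compact_Int_closed full_products_subset inf.absorb_iff2)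
    then have "compact R"
      unfolding R_def using psubset.hyps psubset.prems(1)
      by (intro compact_UN compact_matrix_mult_image compact_closure_generated_semigroup) auto
    moreover have "full_products N \<subseteq> R"
    proof
      fix B assume "B \<in> full_products N"
      then obtain w where w: "set w = N" "B = matrix_product w"
        by (auto simp: full_products_def)
      obtain v a c where vac: "w = v @ a # c" "a \<in> N" "set c = N - {a}"
        using full_word_split[OF w(1) False] by blast
      have "matrix_product v \<in> closure (generated_semigroup N)"
        using w vac by (intro closure_subset[THEN subsetD]) (auto simp: generated_semigroup_eq)
      moreover have "matrix_product c \<in> closure (full_products (N - {a}))"
        using vac by (intro closure_subset[THEN subsetD]) (auto simp: full_products_def)
      ultimately show "B \<in> R"
        unfolding R_def w vac matrix_product_append matrix_product_simps using vac(2) by blast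
    qed
    ultimately have "closure (full_products N) \<subseteq> R"
      by (simp add: closure_minimal compact_imp_closed)
    then obtain a v c where a: "a \<in> N" and v: "v \<in> closure (generated_semigroup N)"
      and c: "c \<in> closure (full_products (N - {a}))" and B: "B = v ** (a ** c)"
      using psubset.prems(2) by (auto simp: R_def)
    have c': "c \<in> closure (generated_semigroup (N - {a}))"
      using c closure_mono[OF full_products_subset] by blast
    have le1: "norm (c *v y) \<le> norm y"
      by (rule closure_generated_semigroup_contraction[OF _ c']) (use psubset.prems(1) in blast)
    have le2: "norm (a *v (c *v y)) \<le> norm (c *v y)"
      using psubset.prems(1)[OF a] by (simp add: paracontraction_def)
    \<comment> \<open>This closes the chain |y| = |B y| <= |a c y| <= |c y| <= |y|, so equality
      holds throughout.\<close>
    have le3: "norm y \<le> norm (a *v (c *v y))"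
      using closure_generated_semigroup_contraction[OF psubset.prems(1) v, of "a *v (c *v y)"] psubset.prems(3)
      by (simp add: B matrix_vector_mul_assoc matrix_mul_assoc)
    have y: "y \<in> common_fixed (N - {a})"
      by (rule psubset.IH[OF _ _ c]) (use a psubset.prems(1) le1 le2 le3 in auto)
    have "c *v y = y"
      by (rule closure_generated_semigroup_fixed[OF c' y])
    with le2 le3 have "norm (a *v y) = norm y" by simp
    then have "a *v y = y"
      using psubset.prems(1)[OF a] by (auto simp: paracontraction_def)
    with y show ?thesis by (auto simp: common_fixed_def)
  qed
qed

text \<open>The constant is the maximum of |B y| over limits \<open>B\<close> of full words and unit
  vectors \<open>y\<close> of the complement, a compact set. It is below 1 because |B y| = 1 would
  put \<open>y\<close> into \<open>common_fixed N\<close> and its complement at once.\<close>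

lemma full_products_uniform_contraction:
  fixes N :: "(real ^ 'n ^ 'n) set"
  assumes "finite N" and para: "\<And>A. A \<in> N \<Longrightarrow> paracontraction A"
  obtains q where "0 \<le> q" "q < 1"
    "\<And>B y. B \<in> full_products N \<Longrightarrow> y \<in> orthogonal_comp (common_fixed N) \<Longrightarrow> norm (B *v y) \<le> q * norm y"
proof -
  define P where "P = orthogonal_comp (common_fixed N)"
  define K where "K = closure (full_products N) \<times> (sphere 0 1 \<inter> P)"
  define f where "f = (\<lambda>(B :: real ^ 'n ^ 'n, y :: real ^ 'n). norm (B *v y))"
  have sub: "closure (full_products N) \<subseteq> closure (generated_semigroup N)"
    by (rule closure_mono[OF full_products_subset])
  have "closed P"
    unfolding P_def by (rule closed_subspace[OF subspace_orthogonal_comp])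
  then have "compact K"
    unfolding K_def using compact_closure_generated_semigroup[OF para] sub
    by (intro compact_Times compact_Int_closed compact_sphere)
      (metis closed_closure compact_Int_closed inf.absorb_iff2)
  moreover have "continuous_on K f"
    unfolding f_def case_prod_unfold by (intro continuous_intros)
  ultimately have cimg: "compact (f ` K)"
    by (rule compact_continuous_image[rotated])
  have lt1: "r < 1" if r: "r \<in> f ` K" for r
  proof -
    obtain B y where By: "B \<in> closure (full_products N)" "norm y = 1" "y \<in> P" "r = norm (B *v y)"
      using r by (auto simp: K_def f_def)
    have "r \<le> 1"
      using closure_generated_semigroup_contraction[OF para, where x = y and B = B] By sub by auto
    moreover have "r \<noteq> 1"
    proof
      assume "r = 1"
      then have "y \<in> common_fixed N"
        using closure_full_products_norm_eq[OF assms By(1)] By by simp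
      then have "y \<bullet> y = 0"
        using By(3) by (auto simp: P_def orthogonal_comp_def orthogonal_def)
      then show False using By(2) by simp
    qed
    ultimately show ?thesis by simp
  qed
  obtain q where q: "0 \<le> q" "q < 1" "\<And>r. r \<in> f ` K \<Longrightarrow> r \<le> q"
  proof (cases "f ` K = {}")
    case True
    then show ?thesis using that[of 0] by auto
  next
    case False
    then obtain m where m: "m \<in> f ` K" "\<And>r. r \<in> f ` K \<Longrightarrow> r \<le> m"
      using compact_attains_sup[OF cimg] by blast
    have "0 \<le> m" using m(1) by (auto simp: f_def)
    then show ?thesis using that[of m] m lt1 by blast
  qed
  show ?thesis
  proof (rule that[OF q(1,2)])
    fix B y assume B: "B \<in> full_products N" and y: "y \<in> orthogonal_comp (common_fixed N)"
    show "norm (B *v y) \<le> q * norm y"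
    proof (cases "y = 0")
      case False
      have "y /\<^sub>R norm y \<in> P"
        using y subspace_scale[OF subspace_orthogonal_comp] by (auto simp: P_def)
      then have "(B, y /\<^sub>R norm y) \<in> K"
        using B False closure_subset[of "full_products N"] by (auto simp: K_def)
      then have "norm (B *v (y /\<^sub>R norm y)) \<le> q"
        using q(3) by (force simp: f_def)
      then show ?thesis
        using False by (simp add: matrix_vector_mult_scaleR field_simps)
    qed simp
  qed
qed

section \<open>Finite generation of the closure\<close>

lemma finitely_generated_closure_paracontractions:
  fixes N :: "(real ^ 'n ^ 'n) set"
  assumes "finite N" "\<And>A. A \<in> N \<Longrightarrow> paracontraction A"
  shows "finitely_generated (closure (generated_semigroup N))"
  using assms
proof (induction N rule: finite_psubset_induct)
  case (psubset N)
  note para = psubset.prems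
  let ?G = "generated_semigroup N"
  let ?m = "\<lambda>K L. (\<lambda>(A, B). A ** B) ` (K \<times> L)"
  have "\<exists>F. finite F \<and> closure (generated_semigroup K) = generated_semigroup F" if "K \<subset> N" for K
    using psubset.IH[OF that] that para unfolding finitely_generated_def by blast
  then obtain F where F: "\<And>K. K \<subset> N \<Longrightarrow> finite (F K)"
    "\<And>K. K \<subset> N \<Longrightarrow> closure (generated_semigroup K) = generated_semigroup (F K)"
    by metis
  \<comment> \<open>\<open>mat 1\<close> is inserted for the case \<open>N = {}\<close>, which has
    no proper subset to supply the empty word.\<close>
  define C where "C = insert (mat 1) (\<Union>K\<in>{K. K \<subset> N}. closure (generated_semigroup K))"
  define W where "W = (\<Union>a\<in>N. ?m {a} (closure (generated_semigroup (N - {a}))))"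
  \<comment> \<open>Blocks are split off on the right. \<open>Z m\<close> consists of an element of
    \<open>C\<close> followed by fewer than \<open>m\<close> factors from \<open>W\<close>, hence
    \<open>Z 0\<close> is empty; \<open>Q m\<close> is a word followed by exactly \<open>m\<close>
    full products.\<close>
  define Z where "Z = rec_nat ({} :: (real ^ 'n ^ 'n) set) (\<lambda>_ Z. C \<union> ?m Z W)"
  define Q where "Q = rec_nat ?G (\<lambda>_ Q. ?m Q (full_products N))"
  have Z: "Z 0 = {}" "Z (Suc m) = C \<union> ?m (Z m) W" and Q: "Q 0 = ?G" "Q (Suc m) = ?m (Q m) (full_products N)" for m
    by (simp_all add: Z_def Q_def)
  have finsub: "finite {K. K \<subset> N}"
    using psubset.hyps by (rule_tac finite_subset[of _ "Pow N"]) auto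
  have "compact C"
    unfolding C_def using finsub para by (intro compact_insert compact_UN compact_closure_generated_semigroup) auto
  moreover have "compact W"
    unfolding W_def using psubset.hyps para
    by (intro compact_UN compact_matrix_mult_image compact_closure_generated_semigroup) auto
  ultimately have compact_Z: "compact (Z m)" for m
    by (induction m) (auto simp: Z intro!: compact_Un compact_matrix_mult_image)
  have C_sub: "C \<subseteq> closure ?G"
    unfolding C_def using mat_1_in_closure_generated_semigroup closure_mono[OF generated_semigroup_mono]
    by (auto; blast)

  \<comment> \<open>A word missing a letter lies in \<open>C\<close>. Otherwise its last block
    \<open>a # c\<close> belongs both to \<open>W\<close> and to \<open>full_products N\<close>, so
    it extends either alternative for the prefix.\<close>
  have word_cases: "matrix_product w \<in> Z m \<union> Q m" if "set w \<subseteq> N" for w m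
    using that
  proof (induction m arbitrary: w)
    case 0
    then show ?case by (auto simp: Q generated_semigroup_eq)
  next
    case (Suc m)
    show ?case
    proof (cases "set w = N \<and> N \<noteq> {}")
      case True
      then obtain v a c where w: "w = v @ a # c" "a \<in> N" "set c = N - {a}"
        using full_word_split by metis
      have "set (a # c) = N" using w by auto
      then have full: "a ** matrix_product c \<in> full_products N"
        unfolding full_products_def by (metis (mono_tags) image_eqI matrix_product_simps(2) mem_Collect_eq)
      have "matrix_product c \<in> closure (generated_semigroup (N - {a}))"
        using w by (intro closure_subset[THEN subsetD]) (auto simp: generated_semigroup_eq)
      then have inW: "a ** matrix_product c \<in> W"
        using w(2) by (auto simp: W_def)
      have "matrix_product v \<in> Z m \<union> Q m"
        using Suc w by auto
      then show ?thesis
        unfolding w matrix_product_append matrix_product_simps Z Q using full inW by blast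
    next
      case False
      show ?thesis
      proof (cases "N = {}")
        case True
        then show ?thesis
          using Suc.prems by (simp add: Z C_def)
      next
        case nonempty: False
        then have "set w \<subset> N" using Suc.prems False by blast
        then have "matrix_product w \<in> C"
          unfolding C_def
          by (intro insertI2 UN_I[of "set w"] closure_subset[THEN subsetD]) (auto simp: generated_semigroup_eq)
        then show ?thesis by (simp add: Z)
      qed
    qed
  qed
  have closure_cases: "closure ?G \<subseteq> Z m \<union> closure (Q m)" for m
  proof -
    have "?G \<subseteq> Z m \<union> Q m"
      using word_cases by (auto simp: generated_semigroup_eq)
    then have "closure ?G \<subseteq> closure (Z m) \<union> closure (Q m)"
      by (metis closure_Un closure_mono)
    then show ?thesis by (simp add: compact_Z compact_imp_closed)
  qed

  obtain q where q: "0 \<le> q" "q < 1" "\<And>B y. B \<in> full_products N \<Longrightarrow>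
      y \<in> orthogonal_comp (common_fixed N) \<Longrightarrow> norm (B *v y) \<le> q * norm y"
    using full_products_uniform_contraction[OF psubset.hyps(1) para] by blast
  \<comment> \<open>Each full factor contributes \<open>q\<close> and stays in the complement; the
    leading word does not increase the norm.\<close>
  have Q_contr: "norm (B *v y) \<le> q ^ m * norm y"
    if "B \<in> Q m" "y \<in> orthogonal_comp (common_fixed N)" for B y m
    using that
  proof (induction m arbitrary: B y)
    case 0
    then show ?case using generated_semigroup_contraction[OF para] by (simp add: Q)
  next
    case (Suc m)
    then obtain D E where D: "D \<in> Q m" and E: "E \<in> full_products N" and B: "B = D ** E"
      by (auto simp: Q)
    have "E *v y \<in> orthogonal_comp (common_fixed N)"
      using orthogonal_complement_fixed_invariant[OF para _ Suc.prems(2)] E full_products_subset closure_subset by blast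
    then have "norm (B *v y) \<le> q ^ m * norm (E *v y)"
      using Suc.IH[OF D] by (simp add: B matrix_vector_mul_assoc[symmetric])
    also have "\<dots> \<le> q ^ m * (q * norm y)"
      using q(3)[OF E Suc.prems(2)] q(1) by (intro mult_left_mono) auto
    finally show ?case by (simp add: mult.assoc mult.left_commute)
  qed
  \<comment> \<open>These limits lie in the closure of every \<open>Q m\<close>, so
    \<open>q ^ m\<close> tending to 0 makes them vanish on the complement. As they fix
    \<open>common_fixed N\<close>, only the orthogonal projection is possible.\<close>
  define L where "L = closure ?G - (\<Union>m. Z m)"
  have L_zero: "B *v y = 0" if B: "B \<in> L" and y: "y \<in> orthogonal_comp (common_fixed N)" for B y
  proof -
    have "norm (B *v y) \<le> q ^ m * norm y" for m
    proof -
      have "closure (Q m) \<subseteq> {B. norm (B *v y) \<le> q ^ m * norm y}"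
        using Q_contr[OF _ y] by (intro closure_minimal closed_Collect_le continuous_intros) auto
      then show ?thesis using B closure_cases[of m] by (auto simp: L_def)
    qed
    moreover have "(\<lambda>m. q ^ m * norm y) \<longlonglongrightarrow> 0 * norm y"
      using q by (intro tendsto_intros LIMSEQ_power_zero) auto
    ultimately have "norm (B *v y) \<le> 0 * norm y"
      by (intro LIMSEQ_le_const[of "\<lambda>m. q ^ m * norm y"]) auto
    then show ?thesis by simp
  qed
  have L_unique: "A = B" if "A \<in> L" "B \<in> L" for A B
  proof (rule matrix_eq[THEN iffD2], rule allI)
    fix x :: "real ^ 'n"
    have "subspace (common_fixed N)"
      by (auto simp: subspace_def common_fixed_def matrix_vector_right_distrib matrix_vector_mult_scaleR)
    then have span: "span (common_fixed N) = common_fixed N"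
      by (rule span_eq_iff[THEN iffD2])
    obtain e y where e: "e \<in> common_fixed N" and x: "x = e + y"
      and "\<And>z. z \<in> common_fixed N \<Longrightarrow> orthogonal y z"
      using orthogonal_subspace_decomp_exists[of "common_fixed N" x] unfolding span by blast
    then have y: "y \<in> orthogonal_comp (common_fixed N)"
      by (simp add: orthogonal_comp_def orthogonal_commute)
    have "A *v e = e" "B *v e = e"
      using that e closure_generated_semigroup_fixed by (auto simp: L_def)
    then show "A *v x = B *v x"
      using L_zero[OF _ y] that by (simp add: x matrix_vector_right_distrib)
  qed
  have "finite L"
  proof (cases "L = {}")
    case False
    then obtain B where "B \<in> L" by blast
    with L_unique have "L \<subseteq> {B}" by blast
    then show ?thesis by (rule finite_subset) simp
  qed simp

  \<comment> \<open>\<open>N\<close> supplies the letters in \<open>W\<close>, the sets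
    \<open>F K\<close> generate the limits over proper subsets, and \<open>L\<close> has at most one
    element.\<close>
  define F' where "F' = N \<union> (\<Union>K\<in>{K. K \<subset> N}. F K) \<union> L"
  have "finite F'"
    unfolding F'_def using psubset.hyps finsub F(1) \<open>finite L\<close> by blast
  have sub: "closure (generated_semigroup K) \<subseteq> generated_semigroup F'" if "K \<subset> N" for K
    unfolding F(2)[OF that] by (rule generated_semigroup_mono) (use that in \<open>auto simp: F'_def\<close>)
  have "C \<subseteq> generated_semigroup F'"
    unfolding C_def using sub generated_semigroup.identity by blast
  moreover have "W \<subseteq> generated_semigroup F'"
  proof
    fix B assume "B \<in> W"
    then obtain a c where "a \<in> N" "c \<in> closure (generated_semigroup (N - {a}))" and B: "B = a ** c"
      by (auto simp: W_def)
    then have "a \<in> generated_semigroup F'" "c \<in> generated_semigroup F'"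
      using sub[of "N - {a}"] by (auto simp: F'_def intro: generated_semigroup.generator)
    then show "B \<in> generated_semigroup F'"
      unfolding B by (rule generated_semigroup.product)
  qed
  ultimately have "Z m \<subseteq> generated_semigroup F'" for m
    by (induction m) (auto simp: Z intro: generated_semigroup.product)
  moreover have "L \<subseteq> generated_semigroup F'"
    by (auto simp: F'_def intro: generated_semigroup.generator)
  ultimately have "closure ?G \<subseteq> generated_semigroup F'"
    unfolding L_def by blast
  moreover have "generated_semigroup F' \<subseteq> closure ?G"
  proof (rule generated_semigroup_least)
    have "F K \<subseteq> C" if "K \<subset> N" for K
      using that F(2)[OF that] by (auto simp: C_def intro: generated_semigroup.generator)
    then show "F' \<subseteq> closure ?G"
      using C_sub closure_subset[of ?G] unfolding F'_def L_def
      by (auto intro: generated_semigroup.generator)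
  qed (auto intro: mat_1_in_closure_generated_semigroup closure_generated_semigroup_mult)
  ultimately show ?case
    unfolding finitely_generated_def using \<open>finite F'\<close> by blast
qed

section \<open>Profinite semigroups\<close>

text \<open>Open classes are also closed, since the complement of a class is a union of
  classes.\<close>

definition clopen_congruences :: "'a topology \<Rightarrow> ('a \<Rightarrow> 'a \<Rightarrow> 'a) \<Rightarrow> ('a \<times> 'a) set set" where
  "clopen_congruences X f = {R. equiv (topspace X) R \<and> (\<forall>x\<in>topspace X. openin X (R `` {x})) \<and>
     (\<forall>x y s t. (x, y) \<in> R \<longrightarrow> (s, t) \<in> R \<longrightarrow> (f x s, f y t) \<in> R)}"

text \<open>The classes form a disjoint open cover by nonempty sets, so a finite subcover must
  contain all of them.\<close>

lemma finite_quotient_clopen_congruence: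
  assumes "compact_space X" "R \<in> clopen_congruences X f"
  shows "finite (topspace X // R)"
proof -
  have eq: "equiv (topspace X) R" and "\<And>x. x \<in> topspace X \<Longrightarrow> openin X (R `` {x})"
    using assms(2) by (auto simp: clopen_congruences_def)
  then have "\<forall>U\<in>topspace X // R. openin X U"
    by (auto elim!: quotientE)
  moreover have "\<Union> (topspace X // R) = topspace X"
    using eq by (rule Union_quotient)
  ultimately obtain \<F> where \<F>: "finite \<F>" "\<F> \<subseteq> topspace X // R" "\<Union>\<F> = topspace X"
    using assms(1) unfolding compact_space by meson
  have "topspace X // R \<subseteq> \<F>"
  proof
    fix c assume c: "c \<in> topspace X // R"
    then obtain x where x: "x \<in> c" "x \<in> topspace X"
      using in_quotient_imp_non_empty[OF eq c] in_quotient_imp_subset[OF eq c] by blast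
    then obtain d where "d \<in> \<F>" "x \<in> d" using \<F>(3) by blast
    moreover have "c = d"
      using quotient_disj[OF eq c, of d] calculation x \<F>(2) by blast
    ultimately show "c \<in> \<F>" by simp
  qed
  then show ?thesis using \<F>(1) by (rule finite_subset)
qed

lemma Int_clopen_congruences:
  assumes "R \<in> clopen_congruences X f" "R' \<in> clopen_congruences X f"
  shows "R \<inter> R' \<in> clopen_congruences X f"
proof -
  have "equiv (topspace X) R" "equiv (topspace X) R'"
    using assms by (auto simp: clopen_congruences_def)
  then have "equiv (topspace X) (R \<inter> R')"
    unfolding equiv_def using refl_on_Int[of "topspace X" R "topspace X" R']
    by (auto intro: sym_Int trans_Int)
  moreover have "(R \<inter> R') `` {x} = R `` {x} \<inter> R' `` {x}" for x by blast
  ultimately show ?thesis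
    using assms by (auto simp: clopen_congruences_def openin_Int)
qed

text \<open>The classes are open by the tube lemma, applied to the compact set of contexts \<open>(s, t)\<close>.\<close>

lemma syntactic_congruence_clopen:
  assumes top: "topological_semigroup X f" and comp: "compact_space X"
    and U: "openin X U" "closedin X U"
  defines "R \<equiv> {(x, y). x \<in> topspace X \<and> y \<in> topspace X \<and>
    (\<forall>s\<in>topspace X. \<forall>t\<in>topspace X. f (f s x) t \<in> U \<longleftrightarrow> f (f s y) t \<in> U)}"
  shows "R \<in> clopen_congruences X f"
proof -
  let ?S = "topspace X"
  have mult: "f x y \<in> ?S" if "x \<in> ?S" "y \<in> ?S" for x y
    using top that by (simp add: topological_semigroup_def semigroup_on_def)
  have assoc: "f (f x y) z = f x (f y z)" if "x \<in> ?S" "y \<in> ?S" "z \<in> ?S" for x y z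
    using top that by (simp add: topological_semigroup_def semigroup_on_def)
  have cont: "continuous_map (prod_topology X X) X (\<lambda>(x, y). f x y)"
    using top by (simp add: topological_semigroup_def)
  have eq: "equiv ?S R"
    by (auto simp: R_def equiv_def refl_on_def sym_def trans_def)
  have congr: "(f x s, f y t) \<in> R" if xy: "(x, y) \<in> R" and st: "(s, t) \<in> R" for x y s t
  proof -
    have mem: "x \<in> ?S" "y \<in> ?S" "s \<in> ?S" "t \<in> ?S" using that by (auto simp: R_def)
    \<comment> \<open>Two replacements: \<open>x\<close> by \<open>y\<close> in the context (a, s
      b), then \<open>s\<close> by \<open>t\<close> in the context (a y, b).\<close>
    have "f (f a (f x s)) b \<in> U \<longleftrightarrow> f (f a (f y t)) b \<in> U" if ab: "a \<in> ?S" "b \<in> ?S" for a b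
    proof -
      have "f (f a (f x s)) b = f (f a x) (f s b)" "f (f a (f y t)) b = f (f (f a y) t) b"
        "f (f a y) (f s b) = f (f (f a y) s) b"
        using mem ab by (simp_all add: assoc mult)
      then show ?thesis
        using xy st ab mem by (simp add: R_def mult)
    qed
    then show ?thesis using mem by (simp add: R_def mult)
  qed
  let ?Y = "prod_topology (prod_topology X X) X"
  define \<phi> where "\<phi> = (\<lambda>((s, t), x). f (f s x) t)"
  have "continuous_map ?Y X (\<lambda>p. (\<lambda>(x, y). f x y) ((\<lambda>(x, y). f x y) (fst (fst p), snd p), snd (fst p)))"
    by (intro continuous_map_compose[OF _ cont, unfolded o_def] continuous_map_pairedI
        continuous_map_compose[OF continuous_map_fst continuous_map_fst, unfolded o_def]
        continuous_map_compose[OF continuous_map_fst continuous_map_snd, unfolded o_def]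
        continuous_map_snd)
  then have cont_\<phi>: "continuous_map ?Y X \<phi>"
    by (simp add: \<phi>_def case_prod_unfold)
  \<comment> \<open>\<open>W\<close> controls the contexts sending \<open>y\<close> into
    \<open>U\<close>, and \<open>W'\<close> those sending it outside. The tube lemma for both gives
    neighbours of \<open>y\<close> that behave alike in every context.\<close>
  define W where "W = {p \<in> topspace ?Y. \<phi> p \<in> U}"
  define W' where "W' = {p \<in> topspace ?Y. \<phi> p \<in> ?S - U}"
  have opW: "openin ?Y W \<and> openin ?Y W'"
    unfolding W_def W'_def using U
    by (intro conjI openin_continuous_map_preimage[OF cont_\<phi>] openin_diff openin_topspace)
  have clW: "closedin ?Y W \<and> closedin ?Y W'"
    unfolding W_def W'_def using U
    by (intro conjI closedin_continuous_map_preimage[OF cont_\<phi>] closedin_diff closedin_topspace)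
  have compXX: "compact_space (prod_topology X X)"
    using comp by (simp add: compact_space_prod_topology)
  have nbhd: "\<exists>V. openin X V \<and> y \<in> V \<and> {p \<in> ?S \<times> ?S. (p, y) \<in> T} \<times> V \<subseteq> T"
    if y: "y \<in> ?S" and T: "openin ?Y T" "closedin ?Y T" for y T
  proof -
    have "continuous_map (prod_topology X X) ?Y (\<lambda>p. (p, y))"
      using y by (simp add: continuous_map_pairedI)
    then have "closedin (prod_topology X X) {p \<in> topspace (prod_topology X X). (p, y) \<in> T}"
      using T(2) by (rule closedin_continuous_map_preimage)
    then have "compactin (prod_topology X X) {p \<in> ?S \<times> ?S. (p, y) \<in> T}"
      using compXX closedin_compact_space by (simp add: topspace_prod_topology)
    then show ?thesis
      using tube_lemma_left[OF T(1) _ y, of "{p \<in> ?S \<times> ?S. (p, y) \<in> T}"] by blast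
  qed
  have open_class: "openin X (R `` {x})" if "x \<in> ?S" for x
  proof (subst openin_subopen, intro ballI)
    fix y assume "y \<in> R `` {x}"
    then have xy: "(x, y) \<in> R" and y: "y \<in> ?S" by (auto simp: R_def)
    obtain V where V: "openin X V" "y \<in> V" "{p \<in> ?S \<times> ?S. (p, y) \<in> W} \<times> V \<subseteq> W"
      using nbhd[OF y, of W] opW clW by blast
    obtain V' where V': "openin X V'" "y \<in> V'" "{p \<in> ?S \<times> ?S. (p, y) \<in> W'} \<times> V' \<subseteq> W'"
      using nbhd[OF y, of W'] opW clW by blast
    have "(y, z) \<in> R" if z: "z \<in> V" "z \<in> V'" for z
    proof -
      have zS: "z \<in> ?S" using z(1) V(1) openin_subset by blast
      have "f (f s y) t \<in> U \<longleftrightarrow> f (f s z) t \<in> U" if st: "s \<in> ?S" "t \<in> ?S" for s t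
      proof (cases "f (f s y) t \<in> U")
        case True
        then have "((s, t), y) \<in> W" using st y by (simp add: W_def \<phi>_def)
        then have "((s, t), z) \<in> W" using V(3) z(1) st by blast
        then show ?thesis using True by (simp add: W_def \<phi>_def)
      next
        case False
        then have "((s, t), y) \<in> W'" using st y by (simp add: W'_def \<phi>_def mult)
        then have "((s, t), z) \<in> W'" using V'(3) z(2) st by blast
        then show ?thesis using False by (simp add: W'_def \<phi>_def)
      qed
      then show ?thesis using y zS by (simp add: R_def)
    qed
    then have "V \<inter> V' \<subseteq> R `` {x}"
      using xy eq by (auto elim: equivE dest: transD)
    then show "\<exists>T. openin X T \<and> y \<in> T \<and> T \<subseteq> R `` {x}"
      using V(1,2) V'(1,2) by (intro exI[of _ "V \<inter> V'"]) (auto simp: openin_Int)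
  qed
  show ?thesis
    using eq congr open_class by (simp add: clopen_congruences_def)
qed

section \<open>Projective limit of the finite quotients\<close>

text \<open>\<open>h\<close> sends a point to its family of classes. Syntactic congruences of
  separating clopen sets make it injective and compactness makes it surjective; a continuous
  bijection from a compact to a Hausdorff space is a homeomorphism.\<close>

lemma profinite_semigroup_if_clopen_separated:
  fixes X :: "'a topology"
  assumes top: "topological_semigroup X f" and comp: "compact_space X"
    and unit: "e \<in> topspace X" "\<And>x. x \<in> topspace X \<Longrightarrow> f e x = x \<and> f x e = x"
    and sep: "\<And>x y. x \<in> topspace X \<Longrightarrow> y \<in> topspace X \<Longrightarrow> x \<noteq> y \<Longrightarrow>
      \<exists>U. openin X U \<and> closedin X U \<and> x \<in> U \<and> y \<notin> U"
  shows "profinite_semigroup X f"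
proof -
  let ?S = "topspace X"
  let ?I = "clopen_congruences X f"
  have mult: "f x y \<in> ?S" if "x \<in> ?S" "y \<in> ?S" for x y
    using top that by (simp add: topological_semigroup_def semigroup_on_def)
  have assoc: "f (f x y) z = f x (f y z)" if "x \<in> ?S" "y \<in> ?S" "z \<in> ?S" for x y z
    using top that by (simp add: topological_semigroup_def semigroup_on_def)
  have eq: "equiv ?S R" and open_class: "\<And>x. x \<in> ?S \<Longrightarrow> openin X (R `` {x})"
    and congr: "\<And>x y s t. (x, y) \<in> R \<Longrightarrow> (s, t) \<in> R \<Longrightarrow> (f x s, f y t) \<in> R" if "R \<in> ?I" for R
    using that by (auto simp: clopen_congruences_def)
  \<comment> \<open>\<open>\<phi> R\<close> numbers the finitely many classes by naturals, and
    \<open>rep R\<close> picks a representative. Multiplication and connecting maps are computed on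
    representatives; the congruence property makes the choice irrelevant.\<close>
  define \<phi> where "\<phi> R x = to_nat_on (?S // R) (R `` {x})" for R x
  define rep where "rep R = inv_into ?S (\<phi> R)" for R
  define T where "T R = \<phi> R ` ?S" for R
  define g where "g R a b = \<phi> R (f (rep R a) (rep R b))" for R a b
  define p where "p R R' a = \<phi> R (rep R' a)" for R R' a
  \<comment> \<open>Finer congruences are larger, so intersections give upper bounds.\<close>
  define le :: "('a \<times> 'a) set \<Rightarrow> ('a \<times> 'a) set \<Rightarrow> bool" where "le R R' \<longleftrightarrow> R' \<subseteq> R" for R R'
  define h where "h x = (\<lambda>R\<in>?I. \<phi> R x)" for x
  have fin: "finite (?S // R)" if "R \<in> ?I" for R
    using finite_quotient_clopen_congruence[OF comp that] .
  have \<phi>_eq: "\<phi> R x = \<phi> R y \<longleftrightarrow> (x, y) \<in> R" if "R \<in> ?I" "x \<in> ?S" "y \<in> ?S" for R x y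
    using that fin[OF that(1)] eq[OF that(1)]
    by (simp add: \<phi>_def quotientI countable_finite eq_equiv_class_iff)
  have rep_in: "rep R a \<in> ?S" and \<phi>_rep: "\<phi> R (rep R a) = a" if "a \<in> T R" for R a
    using that unfolding rep_def T_def by (rule inv_into_into, rule f_inv_into_f)
  have T_in: "\<phi> R x \<in> T R" if "x \<in> ?S" for R x
    using that by (simp add: T_def)
  have rep_\<phi>: "(rep R (\<phi> R x), x) \<in> R" if "R \<in> ?I" "x \<in> ?S" for R x
    using \<phi>_eq[OF that(1) rep_in[OF T_in] that(2)] \<phi>_rep[OF T_in] that by blast
  have g_\<phi>: "g R (\<phi> R x) (\<phi> R y) = \<phi> R (f x y)" if "R \<in> ?I" "x \<in> ?S" "y \<in> ?S" for R x y
    unfolding g_def using that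
    by (intro \<phi>_eq[THEN iffD2] congr rep_\<phi> mult rep_in T_in) auto
  have p_\<phi>: "p R R' (\<phi> R' x) = \<phi> R x" if "R \<in> ?I" "R' \<in> ?I" "le R R'" "x \<in> ?S" for R R' x
    unfolding p_def using that rep_\<phi>[of R' x]
    by (intro \<phi>_eq[THEN iffD2] rep_in T_in) (auto simp: le_def)
  have T_E: thesis if "a \<in> T R" "\<And>x. x \<in> ?S \<Longrightarrow> a = \<phi> R x \<Longrightarrow> thesis" for a R thesis
    using that by (auto simp: T_def)
  have "openin X ?S" by simp
  then have "?S \<times> ?S \<in> ?I"
    using mult by (auto simp: clopen_congruences_def equiv_def refl_on_def sym_def trans_def Image_def)
  then have nonempty: "?I \<noteq> {}" by blast
  have system: "finite_semigroup_inverse_system ?I le T g p"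
  proof
    show "?I \<noteq> {}" by (rule nonempty)
    show "le R R" for R by (simp add: le_def)
    show "le R R''" if "le R R'" "le R' R''" for R R' R'' using that by (auto simp: le_def)
    show "\<exists>R''\<in>?I. le R R'' \<and> le R' R''" if "R \<in> ?I" "R' \<in> ?I" for R R'
      using Int_clopen_congruences[OF that] by (auto simp: le_def)
    show "finite (T R)" if "R \<in> ?I" for R
    proof -
      have "T R \<subseteq> to_nat_on (?S // R) ` (?S // R)"
        by (auto simp: T_def \<phi>_def quotientI)
      then show ?thesis using fin[OF that] by (meson finite_imageI finite_subset)
    qed
    show "semigroup_on (T R) (g R)" if "R \<in> ?I" for R
      unfolding semigroup_on_def
      by (intro conjI ballI; elim T_E; simp add: g_\<phi>[OF that] mult T_in assoc)
    show "semigroup_hom_on (T R') (g R') (T R) (g R) (p R R')"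
      if "R \<in> ?I" "R' \<in> ?I" "le R R'" for R R'
      unfolding semigroup_hom_on_def
      by (intro conjI ballI Pi_I; elim T_E; simp add: g_\<phi> p_\<phi> that mult T_in)
    show "p R R a = a" if "R \<in> ?I" "a \<in> T R" for R a
      using that(2) by (simp add: p_def \<phi>_rep)
    show "p R R' (p R' R'' a) = p R R'' a"
      if "R \<in> ?I" "R' \<in> ?I" "R'' \<in> ?I" "le R R'" "le R' R''" "a \<in> T R''" for R R' R'' a
    proof -
      have "le R R''" using that by (auto simp: le_def)
      with that show ?thesis by (elim T_E) (simp add: p_\<phi>)
    qed
  qed
  let ?L = "projective_limit ?I le T p"
  have h_in: "h x \<in> ?L" if "x \<in> ?S" for x
    using that by (auto simp: projective_limit_def h_def T_in p_\<phi>)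
  have hom: "semigroup_hom_on ?S f ?L (projective_limit_mult ?I g) h"
    using h_in by (auto simp: semigroup_hom_on_def projective_limit_mult_def h_def g_\<phi> intro!: restrict_ext)
  have fibre_open: "openin X {x \<in> ?S. \<phi> R x \<in> A}" if R: "R \<in> ?I" for R A
  proof (subst openin_subopen, intro ballI)
    fix x assume x: "x \<in> {x \<in> ?S. \<phi> R x \<in> A}"
    have "x \<in> R `` {x}" using x eq[OF R] by (auto elim!: equivE dest: refl_onD)
    moreover have "R `` {x} \<subseteq> {x \<in> ?S. \<phi> R x \<in> A}"
    proof
      fix y assume "y \<in> R `` {x}"
      moreover then have y: "y \<in> ?S" using openin_subset[OF open_class[OF R, of x]] x by blast
      ultimately have "\<phi> R x = \<phi> R y" using \<phi>_eq[OF R _ y, of x] x by blast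
      then show "y \<in> {x \<in> ?S. \<phi> R x \<in> A}" using x y by simp
    qed
    ultimately show "\<exists>U. openin X U \<and> x \<in> U \<and> U \<subseteq> {x \<in> ?S. \<phi> R x \<in> A}"
      using open_class[OF R, of x] x by blast
  qed
  have fibre_closed: "closedin X {x \<in> ?S. \<phi> R x = a}" if R: "R \<in> ?I" for R a
  proof -
    have "?S - {x \<in> ?S. \<phi> R x = a} = {x \<in> ?S. \<phi> R x \<in> - {a}}" by blast
    then show ?thesis using fibre_open[OF R, of "- {a}"] by (simp add: closedin_def)
  qed
  have topspace_L: "topspace (projective_limit_topology ?I le T p) = ?L"
    by (auto simp: projective_limit_topology_def projective_limit_def)
  have "continuous_map X (discrete_topology (T R)) (\<phi> R)" if "R \<in> ?I" for R
    using fibre_open[OF that] by (auto simp: continuous_map_def T_in)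
  then have "continuous_map X (product_topology (\<lambda>R. discrete_topology (T R)) ?I) h"
    by (auto simp: continuous_map_componentwise h_def)
  then have cont: "continuous_map X (projective_limit_topology ?I le T p) h"
    unfolding projective_limit_topology_def using h_in by (simp add: continuous_map_in_subtopology)
  have "Hausdorff_space (projective_limit_topology ?I le T p)"
    unfolding projective_limit_topology_def
    by (intro Hausdorff_space_subtopology) (simp add: Hausdorff_space_product_topology)
  moreover have "inj_on h ?S"
  proof (rule inj_onI, rule ccontr)
    fix x y assume xy: "x \<in> ?S" "y \<in> ?S" "h x = h y" "x \<noteq> y"
    obtain U where U: "openin X U" "closedin X U" "x \<in> U" "y \<notin> U"
      using sep[OF xy(1,2,4)] by blast
    define R where "R = {(x, y). x \<in> ?S \<and> y \<in> ?S \<and>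
      (\<forall>s\<in>?S. \<forall>t\<in>?S. f (f s x) t \<in> U \<longleftrightarrow> f (f s y) t \<in> U)}"
    have R: "R \<in> ?I"
      unfolding R_def by (rule syntactic_congruence_clopen[OF top comp U(1,2)])
    \<comment> \<open>The context (e, e) tests membership in \<open>U\<close> itself.\<close>
    have "(x, y) \<notin> R"
      unfolding R_def using U(3,4) unit xy(1,2) by force
    then have "\<phi> R x \<noteq> \<phi> R y" using \<phi>_eq[OF R xy(1,2)] by blast
    with xy(3) show False
      using R by (auto simp: h_def dest: fun_cong[of _ _ R])
  qed
  moreover have "h ` ?S = ?L"
  proof (intro equalityI subsetI)
    fix z assume z: "z \<in> ?L"
    then have zT: "z R \<in> T R" if "R \<in> ?I" for R
      using that by (auto simp: projective_limit_def)
    have zp: "p R R' (z R') = z R" if "R \<in> ?I" "R' \<in> ?I" "le R R'" for R R'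
      using that z by (auto simp: projective_limit_def)
    define c where "c R = {x \<in> ?S. \<phi> R x = z R}" for R
    have finite_lower: "\<exists>R\<in>?I. \<forall>R'\<in>J. le R' R" if "finite J" "J \<subseteq> ?I" for J
      using that
    proof (induction J rule: finite_induct)
      case empty
      then show ?case using nonempty by blast
    next
      case (insert R J)
      then obtain R' where "R' \<in> ?I" "\<forall>R''\<in>J. le R'' R'" by blast
      then show ?case
        using insert.prems Int_clopen_congruences[of R X f R'] by (intro bexI[of _ "R \<inter> R'"]) (auto simp: le_def)
    qed
    \<comment> \<open>A preimage of \<open>z\<close> is a common point of the closed fibres
      \<open>c R\<close>. For finitely many of them, take a point of the fibre over a common upper
      bound; compatibility of \<open>z\<close> puts it into all the others.\<close>
    have "\<Inter> (c ` ?I) \<noteq> {}"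
    proof (rule compact_space_fip[THEN iffD1, rule_format, OF comp], intro conjI ballI allI impI)
      show "closedin X K" if "K \<in> c ` ?I" for K
        using that fibre_closed by (auto simp: c_def)
      fix \<F> assume "finite \<F> \<and> \<F> \<subseteq> c ` ?I"
      then obtain J where J: "finite J" "J \<subseteq> ?I" "\<F> = c ` J"
        by (meson finite_subset_image)
      obtain R where R: "R \<in> ?I" "\<And>R'. R' \<in> J \<Longrightarrow> le R' R"
        using finite_lower[OF J(1,2)] by blast
      obtain x where x: "x \<in> ?S" "z R = \<phi> R x"
        using zT[OF R(1)] T_E by metis
      have "x \<in> c R'" if "R' \<in> J" for R'
        using that zp[of R' R] p_\<phi>[of R' R x] R J x by (auto simp: c_def)
      then show "\<Inter> \<F> \<noteq> {}" using J(3) by blast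
    qed
    then obtain x where x: "\<And>R. R \<in> ?I \<Longrightarrow> x \<in> c R" by blast
    then have "x \<in> ?S" using nonempty by (auto simp: c_def)
    moreover have "h x = z"
      using z x by (intro extensionalityI[of _ ?I]) (auto simp: h_def c_def projective_limit_def PiE_def)
    ultimately show "z \<in> h ` ?S" by blast
  qed (use h_in in blast)
  ultimately have "homeomorphic_map X (projective_limit_topology ?I le T p) h"
    using continuous_imp_homeomorphic_map[OF cont comp] topspace_L by simp
  with system hom top show ?thesis
    unfolding profinite_semigroup_def by blast
qed

section \<open>Countable compact semigroups of matrices\<close>

text \<open>Only countably many distances from \<open>x\<close> occur in \<open>S\<close>, so some
  radius below \<open>dist x y\<close> is not attained; there the open and the closed ball have the
  same trace on \<open>S\<close>.\<close>

lemma countable_clopen_separated: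
  fixes S :: "'a::metric_space set"
  assumes "countable S" "x \<in> S" "y \<in> S" "x \<noteq> y"
  shows "\<exists>U. openin (top_of_set S) U \<and> closedin (top_of_set S) U \<and> x \<in> U \<and> y \<notin> U"
proof -
  have "uncountable ({0<..<dist x y} - dist x ` S)"
    using assms by (intro uncountable_minus_countable) (auto simp: uncountable_open_interval)
  then have "{0<..<dist x y} - dist x ` S \<noteq> {}"
    by (metis countable_empty)
  then obtain r where "r \<in> {0<..<dist x y} - dist x ` S" by blast
  then have r: "0 < r" "r < dist x y" "r \<notin> dist x ` S" by auto
  have "S \<inter> cball x r = S \<inter> ball x r"
    using r(3) by (auto simp: less_le)
  then have "closedin (top_of_set S) (S \<inter> ball x r)"
    by (metis closed_cball closedin_closed_Int)
  moreover have "openin (top_of_set S) (S \<inter> ball x r)"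
    by (simp add: openin_open_Int)
  ultimately show ?thesis
    using r assms by (intro exI[of _ "S \<inter> ball x r"]) auto
qed

theorem corollary5p10:
  fixes \<epsilon> :: real and \<M> :: "(real ^ 'n ^ 'n) set"
  assumes "0 < \<epsilon>" and "\<epsilon> \<le> 1 / (2 * real CARD('n))"
    and "finite \<M>" and "\<M> \<subseteq> domestic_matrices \<epsilon>"
  shows "finitely_generated (closure (generated_semigroup \<M>)) \<and>
    profinite_semigroup (top_of_set (closure (generated_semigroup \<M>))) (**)"
proof
  let ?S = "closure (generated_semigroup \<M>)"
  have para: "paracontraction A" if "A \<in> \<M>" for A
    using domestic_imp_paracontraction[OF assms(1)] assms(4) that by blast
  show "finitely_generated ?S"
    by (rule finitely_generated_closure_paracontractions[OF assms(3) para])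
  \<comment> \<open>Finite generation is applied to the closure itself: its elements are words over
    a finite alphabet.\<close>
  then have "countable ?S"
    unfolding finitely_generated_def
    by (metis countable_finite countable_image countable_lists generated_semigroup_eq)
  moreover have "compact_space (top_of_set ?S)"
    using compact_closure_generated_semigroup[OF para] by (simp add: compact_space_subtopology)
  moreover have "topological_semigroup (top_of_set ?S) (**)"
    using closure_generated_semigroup_mult
    by (auto simp: topological_semigroup_def semigroup_on_def matrix_mul_assoc case_prod_unfold
        intro!: continuous_intros)
  ultimately show "profinite_semigroup (top_of_set ?S) (**)"
    by (intro profinite_semigroup_if_clopen_separated[of _ _ "mat 1"] countable_clopen_separated)
      (auto simp: mat_1_in_closure_generated_semigroup)
qed

end
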